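(* Let $\alpha=\{\alpha_k\}_{k=0}^\infty$ be a sequence of real numbers and let $n\in\mathbb{N}$. Define the operator $U_\alpha$ on polynomials by $U_\alpha(\sum_{k=0}^n a_kz^k)=\sum_{k=0}^n b_kz^k$, where $b_k=\sum_{j=0}^\infty\alpha_ja_{k-j}a_{k+j}$ and $a_j=0$ for $j\notin\{0,\dots,n\}$. The following are equivalent: (i) $U_\alpha(\mathcal{P}^+_n)\subseteq\mathcal{P}^+_n\cup\{0\}$; (ii) $U_\alpha((1+z)^n)\in\mathcal{P}^+_n\cup\{0\}$; (iii) $$\sum_{k=0}^{\lfloor n/2\rfloor}\left(\sum_{j=0}^k\frac{\alpha_j}{(k+j)!(k-j)!}\right)\frac{z^k}{(n-2k)!}\in\mathcal{P}^+_n\cup\{0\}.$$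
   Context: $\mathcal{P}^+_n$ denotes the set of all (nonzero) polynomials of degree at most $n$ with only real and non-positive zeros. *)

theory Defs
  imports "HOL-Analysis.Analysis" "HOL-Computational_Algebra.Computational_Algebra"
begin

definition P_plus :: "nat \<Rightarrow> complex poly set" where
  "P_plus n = {f. f \<noteq> 0 \<and> degree f \<le> n \<and> (\<forall>z. poly f z = 0 \<longrightarrow> z \<in> \<real> \<and> Re z \<le> 0)}"

(* Integer-indexed coefficients, so that a_j = 0 also for negative j. *)
definition icoeff :: "complex poly \<Rightarrow> int \<Rightarrow> complex" where
  "icoeff f j = (if j < 0 then 0 else coeff f (nat j))"

definition U_coeff :: "(nat \<Rightarrow> real) \<Rightarrow> complex poly \<Rightarrow> nat \<Rightarrow> complex" where
  "U_coeff \<alpha> f k =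
     (\<Sum>j. complex_of_real (\<alpha> j) * icoeff f (int k - int j) * icoeff f (int k + int j))"

(* The summation bound "degree f" may be replaced by any n >= degree f; see U_op_eq below. *)
definition U_op :: "(nat \<Rightarrow> real) \<Rightarrow> complex poly \<Rightarrow> complex poly" where
  "U_op \<alpha> f = (\<Sum>k\<le>degree f. monom (U_coeff \<alpha> f k) k)"

(* The series defining U_coeff has at most k + 1 nonzero terms. *)
lemma U_coeff_eq:
  "U_coeff \<alpha> f k = (\<Sum>j\<le>k. complex_of_real (\<alpha> j) * coeff f (k - j) * coeff f (k + j))"
proof -
  have "U_coeff \<alpha> f k =
      (\<Sum>j\<le>k. complex_of_real (\<alpha> j) * icoeff f (int k - int j) * icoeff f (int k + int j))"
    unfolding U_coeff_def by (rule suminf_finite) (auto simp: icoeff_def)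
  also have "\<dots> = (\<Sum>j\<le>k. complex_of_real (\<alpha> j) * coeff f (k - j) * coeff f (k + j))"
    by (rule sum.cong) (auto simp: icoeff_def nat_diff_distrib nat_add_distrib)
  finally show ?thesis .
qed

lemma U_coeff_eq_0: "degree f < k \<Longrightarrow> U_coeff \<alpha> f k = 0"
  by (simp add: U_coeff_eq coeff_eq_0)

lemma U_op_eq:
  assumes "degree f \<le> n"
  shows "U_op \<alpha> f = (\<Sum>k\<le>n. monom (U_coeff \<alpha> f k) k)"
  unfolding U_op_def using assms
  by (intro sum.mono_neutral_left) (auto simp: U_coeff_eq_0)

end

(* Write f = \<Prod>(z + \<theta>) with all \<theta> \<ge> 0. The coefficients of f(w u) f(w / u) in u are the sums of products
   a_(l+j) a_(l-j) w^(2 l), so U_\<alpha>(f)(w^2) is a linear functional of \<Prod>(\<theta>^2 + w^2 + \<theta> w t), where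
   t = u + 1/u. Dividing the factors with \<theta> \<noteq> 0 by \<theta> w gives \<Prod>(v_\<theta> + t), where v_\<theta> = \<theta>/w + w/\<theta> has
   positive real part if w has. By the Grace-Walsh-Szego theorem for the right half-plane, the functional
   does not vanish at this product of m factors if it does not vanish at (v + t)^m for any v with Re v > 0.
   Differentiation in v passes this property from n to all m \<le> n, unless the functional is zero there.
   For m = n the polynomial in v is, up to a factor v^n, the polynomial of (iii) at 1/v^2, and f = (1 + z)^n gives
   v = w + 1/w, which maps the right half-plane onto itself. *)
theory Submission
  imports Defs
begin

section \<open>Linear functionals given by their moments, and the associated Appell
  polynomials\<close>

definition lin_functional :: "(nat \<Rightarrow> complex) \<Rightarrow> complex poly \<Rightarrow> complex" where
  "lin_functional c h = (\<Sum>k\<le>degree h. c k * coeff h k)"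

lemma lin_functional_eq:
  assumes "degree h \<le> N"
  shows "lin_functional c h = (\<Sum>k\<le>N. c k * coeff h k)"
  unfolding lin_functional_def using assms
  by (intro sum.mono_neutral_left) (auto simp: coeff_eq_0)

lemma lin_functional_1 [simp]: "lin_functional c 1 = c 0"
  by (simp add: lin_functional_def)

lemma lin_functional_smult: "lin_functional c (smult a h) = a * lin_functional c h"
proof -
  have "lin_functional c (smult a h) = (\<Sum>k\<le>degree h. c k * coeff (smult a h) k)"
    by (rule lin_functional_eq) (simp add: degree_smult_le)
  then show ?thesis
    by (simp add: lin_functional_def sum_distrib_left mult_ac)
qed

text \<open>A linear factor of the argument is absorbed into the moment sequence. Functionals of
  products can thus be treated one factor at a time, by induction with \<open>c\<close>
  arbitrary.\<close>

lemma lin_functional_linear_factor: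
  "lin_functional c ([:v, 1:] * h) = lin_functional (\<lambda>k. v * c k + c (Suc k)) h"
proof -
  let ?N = "Suc (degree h)"
  have "degree ([:v, 1:] * h) \<le> ?N"
    by (rule order_trans[OF degree_mult_le]) simp
  then have "lin_functional c ([:v, 1:] * h) = (\<Sum>k\<le>?N. c k * coeff ([:v, 1:] * h) k)"
    by (rule lin_functional_eq)
  also have "\<dots> = (\<Sum>k\<le>?N. v * c k * coeff h k) + (\<Sum>k\<le>?N. c k * coeff (pCons 0 h) k)"
    by (simp add: algebra_simps flip: sum.distrib del: sum.atMost_Suc)
  also have "(\<Sum>k\<le>?N. v * c k * coeff h k) = (\<Sum>k\<le>degree h. v * c k * coeff h k)"
    by (simp add: coeff_eq_0)
  also have "(\<Sum>k\<le>?N. c k * coeff (pCons 0 h) k) = (\<Sum>k\<le>degree h. c (Suc k) * coeff h k)"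
    by (subst sum.atMost_Suc_shift) simp
  finally show ?thesis
    by (simp add: lin_functional_def algebra_simps sum.distrib)
qed

text \<open>\<open>appell c m\<close> at \<open>v\<close> is the value of the functional \<open>t\<^sup>k \<mapsto> c\<^sub>k\<close> at \<open>(v + t)\<^sup>m\<close>.\<close>

definition appell :: "(nat \<Rightarrow> complex) \<Rightarrow> nat \<Rightarrow> complex poly" where
  "appell c m = (\<Sum>i\<le>m. monom (of_nat (m choose i) * c (m - i)) i)"

lemma coeff_appell: "coeff (appell c m) i = of_nat (m choose i) * c (m - i)"
proof -
  have "coeff (appell c m) i =
      (\<Sum>j\<le>m. if j = i then of_nat (m choose j) * c (m - j) else 0)"
    unfolding appell_def coeff_sum by (rule sum.cong) auto
  then show ?thesis by (simp add: sum.delta)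
qed

lemma degree_appell_le: "degree (appell c m) \<le> m"
  by (rule degree_le) (simp add: coeff_appell)

lemma poly_appell: "poly (appell c m) v = (\<Sum>i\<le>m. of_nat (m choose i) * c (m - i) * v ^ i)"
  by (simp add: appell_def poly_sum poly_monom)

text \<open>Pascal's rule, reflecting (v + t)^(m+1) = v (v + t)^m + t (v + t)^m.\<close>

lemma appell_Suc:
  "appell c (Suc m) = pCons 0 (appell c m) + appell (\<lambda>k. c (Suc k)) m"
proof (rule poly_eqI)
  fix i
  show "coeff (appell c (Suc m)) i =
      coeff (pCons 0 (appell c m) + appell (\<lambda>k. c (Suc k)) m) i"
  proof (cases i)
    case (Suc j)
    show ?thesis
    proof (cases "j < m")
      case True
      then have "Suc (m - Suc j) = m - j" by simp
      then show ?thesis by (simp add: Suc coeff_appell algebra_simps)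
    qed (simp add: Suc coeff_appell binomial_eq_0)
  qed (simp add: coeff_appell)
qed

text \<open>Formally d/dv (v + t)^(m+1) = (m+1) (v + t)^m: differentiation lowers the order and
  keeps the functional.\<close>

lemma pderiv_appell: "pderiv (appell c (Suc m)) = smult (of_nat (Suc m)) (appell c m)"
proof (rule poly_eqI)
  fix i
  have "of_nat (Suc i) * of_nat (Suc m choose Suc i) = (of_nat (Suc m) * of_nat (m choose i) :: complex)"
    by (simp only: of_nat_mult[symmetric] Suc_times_binomial_eq mult.commute)
  then show "coeff (pderiv (appell c (Suc m))) i = coeff (smult (of_nat (Suc m)) (appell c m)) i"
    by (simp only: coeff_pderiv coeff_appell coeff_smult diff_Suc_Suc mult.assoc[symmetric])
qed

lemma appell_shift_comb:
  "appell (\<lambda>k. a * c k + b * d k) m = smult a (appell c m) + smult b (appell d m)"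
  by (rule poly_eqI) (simp add: coeff_appell algebra_simps)

lemma lin_functional_linear_power:
  "lin_functional c ([:v, 1:] ^ m) = poly (appell c m) v"
proof (induction m arbitrary: c)
  case (Suc m)
  show ?case
    using appell_shift_comb[of v c 1 "\<lambda>k. c (Suc k)" m]
    by (simp only: power_Suc lin_functional_linear_factor Suc) (simp add: appell_Suc)
qed (simp add: poly_appell)

section \<open>Zero-free half-planes: Gauss-Lucas, Laguerre and Grace-Walsh-Szego\<close>

text \<open>The map \<open>s \<mapsto> 1 / s\<close> carries the half-plane \<open>Re s \<ge> a\<close> into a disc through \<open>0\<close>.\<close>

lemma half_plane_inversion:
  fixes s :: complex
  assumes "s \<noteq> 0" "a > 0"
  shows "cmod (1 / s - of_real (1 / (2 * a))) \<le> 1 / (2 * a) \<longleftrightarrow> a \<le> Re s"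
proof -
  have "1 / s - of_real (1 / (2 * a)) = (of_real (2 * a) - s) / (s * of_real (2 * a))"
    using assms by (simp add: field_simps)
  then have "cmod (1 / s - of_real (1 / (2 * a))) =
      cmod (of_real (2 * a) - s) / cmod s * (1 / (2 * a))"
    using assms by (simp add: norm_divide norm_mult)
  then have "cmod (1 / s - of_real (1 / (2 * a))) \<le> 1 / (2 * a) \<longleftrightarrow>
      cmod (of_real (2 * a) - s) / cmod s * (1 / (2 * a)) \<le> 1 * (1 / (2 * a))"
    by (simp only: mult_1)
  also have "\<dots> \<longleftrightarrow> cmod (of_real (2 * a) - s) / cmod s \<le> 1"
    using assms by (intro mult_le_cancel_right_pos) simp
  also have "\<dots> \<longleftrightarrow> cmod (of_real (2 * a) - s) \<le> cmod s"
    using assms by (simp add: divide_le_eq)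
  also have "\<dots> \<longleftrightarrow> (cmod (of_real (2 * a) - s))\<^sup>2 \<le> (cmod s)\<^sup>2"
    by (simp add: abs_le_square_iff[symmetric])
  \<comment> \<open>The two squares differ by 4a(a - Re s).\<close>
  also have "\<dots> \<longleftrightarrow> a * a \<le> a * Re s"
    unfolding cmod_power2 by (simp add: power2_eq_square algebra_simps)
  also have "\<dots> \<longleftrightarrow> a \<le> Re s"
    using assms by simp
  finally show ?thesis .
qed

lemma poly_pderiv_prod_roots:
  fixes z :: complex
  assumes "z \<notin># A"
  shows "poly (pderiv (\<Prod>x\<in>#A. [:-x, 1:])) z =
    poly (\<Prod>x\<in>#A. [:-x, 1:]) z * (\<Sum>x\<in>#A. 1 / (z - x))"
  using assms
proof (induction A)
  case (add x A)
  let ?p = "\<Prod>x\<in>#A. [:-x, 1:]"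
  have "z - x \<noteq> 0" using add.prems by auto
  have "poly (pderiv (\<Prod>y\<in>#add_mset x A. [:-y, 1:])) z = poly ?p z + (z - x) * poly (pderiv ?p) z"
    by (simp only: image_mset_add_mset prod_mset.add_mset pderiv_mult) (simp add: pderiv_pCons del: mult_pCons_left)
  also have "\<dots> = (z - x) * poly ?p z * (1 / (z - x) + (\<Sum>x\<in>#A. 1 / (z - x)))"
    using add \<open>z - x \<noteq> 0\<close> by (simp add: distrib_left)
  finally show ?case by (simp add: algebra_simps)
qed simp

lemma poly_roots_exist:
  fixes p :: "complex poly"
  assumes "p \<noteq> 0"
  obtains A where "size A = degree p" "p = smult (lead_coeff p) (\<Prod>x\<in>#A. [:-x, 1:])"
    "\<And>x. x \<in># A \<Longrightarrow> poly p x = 0"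
proof -
  obtain A where A: "size A = degree p" "p = smult (lead_coeff p) (\<Prod>x\<in>#A. [:-x, 1:])"
    using alg_closed_imp_factorization[OF assms] by blast
  have "poly p x = 0" if "x \<in># A" for x
    by (subst A(2)) (use that in \<open>auto simp: poly_prod_mset prod_mset_zero_iff\<close>)
  with A that show thesis by blast
qed

text \<open>Stability puts all roots into the closed left half-plane. The logarithmic derivative
  over these roots serves both Gauss-Lucas and Laguerre.\<close>

lemma stable_log_deriv:
  fixes p :: "complex poly"
  assumes stable: "\<And>z. Re z > 0 \<Longrightarrow> poly p z \<noteq> 0" and z: "Re z > 0"
  obtains A where "size A = degree p" "\<And>x. x \<in># A \<Longrightarrow> Re x \<le> 0"
    "poly (pderiv p) z = poly p z * (\<Sum>x\<in>#A. 1 / (z - x))"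
proof -
  have "p \<noteq> 0" using stable[OF z] by auto
  then obtain A where A: "size A = degree p" "p = smult (lead_coeff p) (\<Prod>x\<in>#A. [:-x, 1:])"
    "\<And>x. x \<in># A \<Longrightarrow> poly p x = 0"
    by (rule poly_roots_exist) blast
  have "z \<notin># A" using A(3) stable z by blast
  then have "poly (pderiv p) z = poly p z * (\<Sum>x\<in>#A. 1 / (z - x))"
    by (subst (1 2) A(2)) (simp add: pderiv_smult poly_pderiv_prod_roots)
  moreover have "Re x \<le> 0" if "x \<in># A" for x
    using A(3)[OF that] stable[of x] by force
  ultimately show thesis using that A(1) by blast
qed

text \<open>Gauss-Lucas for the right half-plane: each 1/(z - x) has positive real part, so the
  logarithmic derivative cannot vanish.\<close>

lemma stable_pderiv:
  fixes p :: "complex poly"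
  assumes stable: "\<And>z. Re z > 0 \<Longrightarrow> poly p z \<noteq> 0" and z: "Re z > 0" and "degree p > 0"
  shows "poly (pderiv p) z \<noteq> 0"
proof -
  obtain A where A: "size A = degree p" "\<And>x. x \<in># A \<Longrightarrow> Re x \<le> 0"
    "poly (pderiv p) z = poly p z * (\<Sum>x\<in>#A. 1 / (z - x))"
    using stable_log_deriv[OF stable z] by blast
  have "A = {#} \<or> Re (\<Sum>x\<in>#A. 1 / (z - x)) > 0"
    using A(2)
  proof (induction A)
    case (add x A)
    then have "Re x \<le> 0" by simp
    then have "Re (z - x) > 0" using z by simp
    then have "Re (1 / (z - x)) > 0"
      by (simp add: Re_complex_div_gt_0)
    with add show ?case by auto
  qed simp
  with A assms show ?thesis by auto
qed

text \<open>Laguerre's theorem on polar derivatives: the logarithmic derivative at \<open>z\<close> is a sum of at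
  most \<open>N\<close> points of a disc containing \<open>0\<close>, and \<open>1 / (z - \<zeta>)\<close> lies outside this disc.\<close>

lemma stable_polar_derivative:
  fixes p :: "complex poly"
  assumes stable: "\<And>z. Re z > 0 \<Longrightarrow> poly p z \<noteq> 0" and z: "Re z > 0" and \<zeta>: "Re \<zeta> > 0"
    and deg: "degree p \<le> N" and N: "N > 0"
  shows "of_nat N * poly p z + (\<zeta> - z) * poly (pderiv p) z \<noteq> 0"
proof
  assume eq: "of_nat N * poly p z + (\<zeta> - z) * poly (pderiv p) z = 0"
  obtain A where A: "size A = degree p" "\<And>x. x \<in># A \<Longrightarrow> Re x \<le> 0"
    "poly (pderiv p) z = poly p z * (\<Sum>x\<in>#A. 1 / (z - x))"
    using stable_log_deriv[OF stable z] by blast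
  let ?L = "\<Sum>x\<in>#A. 1 / (z - x)"
  \<comment> \<open>Center and radius of the disc obtained by inverting the half-plane Re s \<ge> Re
    z, which contains every z - x.\<close>
  define r where "r = 1 / (2 * Re z)"
  have r: "r > 0" using z by (simp add: r_def)
  have "poly p z * (of_nat N - (z - \<zeta>) * ?L) = 0"
    using eq unfolding A(3) by (simp add: algebra_simps)
  with stable[OF z] have L: "(z - \<zeta>) * ?L = of_nat N" by simp
  with N have ne: "z - \<zeta> \<noteq> 0" by auto
  have "cmod (?L - of_nat (size A) * of_real r) \<le> size A * r"
    using A(2)
  proof (induction A)
    case (add x A)
    have "z - x \<noteq> 0" "Re z \<le> Re (z - x)" using add.prems[of x] z by auto
    then have "cmod (1 / (z - x) - of_real r) \<le> r"
      using half_plane_inversion z unfolding r_def by blast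
    with add have "cmod (1 / (z - x) - of_real r)
        + cmod ((\<Sum>x\<in>#A. 1 / (z - x)) - of_nat (size A) * of_real r) \<le> r + size A * r"
      by (intro add_mono) auto
    then have "cmod ((1 / (z - x) - of_real r)
        + ((\<Sum>x\<in>#A. 1 / (z - x)) - of_nat (size A) * of_real r)) \<le> r + size A * r"
      by (rule order_trans[OF norm_triangle_ineq])
    then show ?case by (simp add: algebra_simps)
  qed simp
  \<comment> \<open>The \<open>N - size A\<close> missing summands count as 0, a boundary point of
    the disc, so \<open>?L\<close> divided by \<open>N\<close> is a mean of \<open>N\<close> points
    of the disc.\<close>
  moreover have "cmod (of_nat (N - size A) * of_real r :: complex) = (N - size A) * r"
    using r by (simp add: norm_mult)
  ultimately have "cmod ((?L - of_nat (size A) * of_real r) - of_nat (N - size A) * of_real r)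
      \<le> size A * r + (N - size A) * r"
    by (intro order_trans[OF norm_triangle_ineq4]) linarith
  also have "size A * r + (N - size A) * r = N * r"
    using deg A(1) by (simp add: of_nat_diff algebra_simps)
  also have "(?L - of_nat (size A) * of_real r) - of_nat (N - size A) * of_real r =
      of_nat N * (1 / (z - \<zeta>) - of_real r)"
  proof -
    have "?L = of_nat N / (z - \<zeta>)" using L ne by (simp add: field_simps)
    then show ?thesis using deg A(1) by (simp add: of_nat_diff algebra_simps)
  qed
  finally have "cmod (1 / (z - \<zeta>) - of_real r) \<le> r"
    using N by (simp add: norm_mult)
  then have "Re z \<le> Re (z - \<zeta>)"
    using half_plane_inversion[OF ne z] by (simp add: r_def)
  with \<zeta> show False by simp
qed

text \<open>Absorbing the factor \<zeta> + t into \<open>c\<close> turns the Appell polynomial, up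
  to a constant, into its polar derivative with respect to \<zeta>. By Laguerre's theorem that is
  again zero-free in the half-plane, so the induction hypothesis applies to the new
  functional.\<close>

lemma grace_walsh_szego:
  assumes "\<And>v. Re v > 0 \<Longrightarrow> poly (appell c (size V)) v \<noteq> 0"
    and "\<And>v. v \<in># V \<Longrightarrow> Re v > 0"
  shows "lin_functional c (\<Prod>v\<in>#V. [:v, 1:]) \<noteq> 0"
  using assms
proof (induction V arbitrary: c)
  case empty
  from empty(1)[of 1] show ?case by (simp add: poly_appell)
next
  case (add \<zeta> V)
  let ?m = "size V"
  have "poly (appell (\<lambda>k. \<zeta> * c k + c (Suc k)) ?m) v \<noteq> 0" if "Re v > 0" for v
  proof -
    let ?p = "appell c (Suc ?m)"
    have "of_nat (Suc ?m) * poly ?p v + (\<zeta> - v) * poly (pderiv ?p) v \<noteq> 0"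
      using add.prems that by (intro stable_polar_derivative degree_appell_le) auto
    moreover have "of_nat (Suc ?m) * poly ?p v + (\<zeta> - v) * poly (pderiv ?p) v =
        of_nat (Suc ?m) * (poly ?p v + (\<zeta> - v) * poly (appell c ?m) v)"
      by (simp only: pderiv_appell poly_smult distrib_left mult_ac)
    \<comment> \<open>By \<open>appell_Suc\<close>, \<open>?p\<close> contributes v times
      \<open>appell c ?m\<close>; the added term replaces this v by \<zeta>.\<close>
    moreover have "poly ?p v + (\<zeta> - v) * poly (appell c ?m) v =
        poly (appell (\<lambda>k. \<zeta> * c k + c (Suc k)) ?m) v"
      using appell_shift_comb[of \<zeta> c 1 "\<lambda>k. c (Suc k)" ?m]
      by (simp add: appell_Suc algebra_simps)
    ultimately show ?thesis by auto
  qed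
  then have "lin_functional (\<lambda>k. \<zeta> * c k + c (Suc k)) (\<Prod>v\<in>#V. [:v, 1:]) \<noteq> 0"
    using add by (intro add.IH) auto
  then show ?case
    by (simp only: lin_functional_linear_factor prod_mset.add_mset image_mset_add_mset not_False_eq_True)
qed

text \<open>Downward induction: each differentiation preserves the alternative by
  Gauss-Lucas.\<close>

lemma appell_stable_or_zero:
  assumes "(\<forall>v. Re v > 0 \<longrightarrow> poly (appell c n) v \<noteq> 0) \<or> appell c n = 0" and "m \<le> n"
  shows "(\<forall>v. Re v > 0 \<longrightarrow> poly (appell c m) v \<noteq> 0) \<or> appell c m = 0"
  using \<open>m \<le> n\<close>
proof (induction rule: inc_induct)
  case (step k)
  have eq: "pderiv (appell c (Suc k)) = smult (of_nat (Suc k)) (appell c k)"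
    by (rule pderiv_appell)
  show ?case
  \<comment> \<open>Degree 0 covers the zero polynomial and also nonzero constants, where a stable
    polynomial is followed by zero.\<close>
  proof (cases "degree (appell c (Suc k)) = 0")
    case True
    then have "pderiv (appell c (Suc k)) = 0" by (simp add: pderiv_eq_0_iff)
    then show ?thesis unfolding eq by (simp del: of_nat_Suc)
  next
    case False
    then have "poly (pderiv (appell c (Suc k))) v \<noteq> 0" if "Re v > 0" for v
      using step.IH that by (intro stable_pderiv) auto
    then show ?thesis unfolding eq by auto
  qed
qed (rule assms(1))

text \<open>The coefficients of \<open>appell c m\<close> are nonzero multiples of the moments
  \<open>c 0\<close> to \<open>c m\<close>, so all of these vanish.\<close>

lemma lin_functional_eq_0_if_appell_eq_0:
  assumes "appell c m = 0" and "degree h \<le> m"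
  shows "lin_functional c h = 0"
proof -
  have "c k = 0" if "k \<le> m" for k
    using coeff_appell[of c m "m - k"] that assms(1) by (auto simp: binomial_eq_0_iff)
  then show ?thesis using assms(2) by (auto simp: lin_functional_def)
qed

section \<open>Products of linear factors, and \<open>U_op\<close> as a linear functional of such a
  product\<close>

lemma degree_prod_mset_linear_le:
  fixes a b :: "'b \<Rightarrow> 'a :: comm_ring_1"
  shows "degree (\<Prod>x\<in>#A. [:b x, a x:]) \<le> size A"
proof (induction A)
  case (add x A)
  have "degree ([:b x, a x:] * (\<Prod>x\<in>#A. [:b x, a x:])) \<le> 1 + size A"
    using add by (intro order_trans[OF degree_mult_le] add_mono) auto
  then show ?case by (simp del: mult_pCons_left)
qed simp

text \<open>Substitute t = Y/X into the product of the b + a t and clear denominators. The exponent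
  uses \<open>size A\<close> instead of the degree because some \<open>a x\<close> may be 0.\<close>

lemma prod_mset_homogenize:
  fixes a b :: "'b \<Rightarrow> 'a :: comm_ring_1" and X Y :: "'a poly"
  shows "(\<Prod>x\<in>#A. smult (b x) X + smult (a x) Y) =
    (\<Sum>k\<le>size A. smult (coeff (\<Prod>x\<in>#A. [:b x, a x:]) k) (Y ^ k * X ^ (size A - k)))"
proof (induction A)
  case (add x A)
  let ?d = "size A"
  define h where "h A = (\<Prod>x\<in>#A. [:b x, a x:])" for A
  have h: "h (add_mset x A) = [:b x, a x:] * h A"
    by (simp only: h_def image_mset_add_mset prod_mset.add_mset)
  have deg: "degree (h A) \<le> ?d"
    unfolding h_def by (rule degree_prod_mset_linear_le)
  have "(\<Sum>k\<le>Suc ?d. smult (coeff (h (add_mset x A)) k) (Y ^ k * X ^ (Suc ?d - k))) =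
      (\<Sum>k\<le>Suc ?d. smult (b x * coeff (h A) k) (Y ^ k * X ^ (Suc ?d - k))) +
      (\<Sum>k\<le>Suc ?d. smult (a x * coeff (pCons 0 (h A)) k) (Y ^ k * X ^ (Suc ?d - k)))"
    unfolding h sum.distrib[symmetric]
    by (rule sum.cong) (simp_all add: coeff_pCons smult_add_left split: nat.split)
  also have "(\<Sum>k\<le>Suc ?d. smult (b x * coeff (h A) k) (Y ^ k * X ^ (Suc ?d - k))) =
      smult (b x) X * (\<Sum>k\<le>?d. smult (coeff (h A) k) (Y ^ k * X ^ (?d - k)))"
    using deg by (simp add: coeff_eq_0 sum_distrib_left Suc_diff_le mult_ac)
  also have "(\<Sum>k\<le>Suc ?d. smult (a x * coeff (pCons 0 (h A)) k) (Y ^ k * X ^ (Suc ?d - k))) =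
      smult (a x) Y * (\<Sum>k\<le>?d. smult (coeff (h A) k) (Y ^ k * X ^ (?d - k)))"
    by (subst sum.atMost_Suc_shift) (simp add: sum_distrib_left mult_ac)
  finally show ?case
    using add by (simp add: h_def distrib_right del: sum.atMost_Suc mult_pCons_left)
qed simp

lemma coeff_one_plus_square_power:
  "coeff ([:1, 0, 1:] ^ k :: 'a :: comm_ring_1 poly) m =
    (if even m then of_nat (k choose (m div 2)) else 0)"
proof -
  have "[:1, 0, 1 :: 'a:] ^ k = (monom 1 2 + 1) ^ k"
    by (simp add: monom_altdef numeral_2_eq_2 one_pCons)
  also have "\<dots> = (\<Sum>i\<le>k. monom (of_nat (k choose i)) (2 * i))"
    by (simp add: binomial_ring monom_power of_nat_monom mult_monom)
  finally have "coeff ([:1, 0, 1 :: 'a:] ^ k) m =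
      (\<Sum>i\<le>k. if 2 * i = m then of_nat (k choose i) else 0)"
    by (simp add: coeff_sum)
  also have "\<dots> = (\<Sum>i\<le>k. if i = m div 2 then (if even m then of_nat (k choose (m div 2)) else 0) else 0)"
    by (rule sum.cong) auto
  finally show ?thesis by (simp add: sum.delta binomial_eq_0)
qed

text \<open>The image of \<open>(u + 1 / u)\<^sup>k\<close> under the functional sending \<open>u\<^bsup>2j\<^esup>\<close> to \<open>\<alpha>\<^sub>j\<close> for \<open>j \<ge> 0\<close> and all
  other powers of \<open>u\<close> to \<open>0\<close>.\<close>

definition U_weight :: "(nat \<Rightarrow> real) \<Rightarrow> nat \<Rightarrow> complex" where
  "U_weight \<alpha> k =
    (if even k then \<Sum>j\<le>k div 2. of_real (\<alpha> j) * of_nat (k choose (k div 2 + j)) else 0)"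

text \<open>With l = k - j the sum runs over the triangle j + l \<le> d. It extends to a square
  because l + 2j exceeds the degree outside the triangle, which separates \<open>\<alpha> j\<close>
  from a sum depending on \<open>f\<close> alone.\<close>

lemma poly_U_op_square:
  assumes "degree f \<le> d"
  shows "poly (U_op \<alpha> f) (w\<^sup>2) =
    (\<Sum>j\<le>d. of_real (\<alpha> j) * (\<Sum>l\<le>d. coeff f l * coeff f (l + 2 * j) * w ^ (2 * (l + j))))"
    (is "?lhs = ?rhs")
proof -
  define g where "g j l = of_real (\<alpha> j) * (coeff f l * coeff f (l + 2 * j) * w ^ (2 * (l + j)))" for j l
  have "?lhs = (\<Sum>k\<le>d. \<Sum>j\<le>k. g j (k - j))"
    unfolding U_op_eq[OF assms] U_coeff_eq poly_sum poly_monom sum_distrib_right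
    by (intro sum.cong) (simp_all add: g_def power_mult[symmetric] mult_ac add.commute mult_2)
  also have "\<dots> = (\<Sum>(j, l)\<in>{(j, l). j + l \<le> d}. g j l)"
    by (rule sum.triangle_reindex_eq[symmetric])
  also have "\<dots> = (\<Sum>(j, l)\<in>{..d} \<times> {..d}. g j l)"
  proof (rule sum.mono_neutral_left)
    have "coeff f (l + 2 * j) = 0" if "d < j + l" for j l
      using assms that by (intro coeff_eq_0) linarith
    then show "\<forall>i\<in>{..d} \<times> {..d} - {(j, l). j + l \<le> d}. (case i of (j, l) \<Rightarrow> g j l) = 0"
      unfolding g_def by (force simp: not_le)
  qed auto
  also have "\<dots> = ?rhs"
    by (simp add: sum.cartesian_product[symmetric] g_def sum_distrib_left)
  finally show ?thesis .
qed

text \<open>For \<open>f\<close> of degree \<open>d\<close>, the coefficient of \<open>u\<^bsup>d + 2j\<^esup>\<close> in \<open>u\<^bsup>d\<^esup> f (w u) f (w / u)\<close> is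
  \<open>\<Sum>\<^sub>l a\<^sub>l a\<^bsub>l + 2j\<^esub> w\<^bsup>2(l + j)\<^esup>\<close>. Each pair of factors
  \<open>(\<theta> + w u) (\<theta> + w / u) = \<theta>\<^sup>2 + w\<^sup>2 + \<theta> w (u + 1 / u)\<close> is linear in \<open>u + 1 / u\<close>.\<close>

lemma poly_U_op_prod:
  fixes A :: "complex multiset"
  assumes w: "w \<noteq> 0"
  shows "poly (U_op \<alpha> (\<Prod>\<theta>\<in>#A. [:\<theta>, 1:])) (w\<^sup>2) =
    lin_functional (U_weight \<alpha>) (\<Prod>\<theta>\<in>#A. [:\<theta>\<^sup>2 + w\<^sup>2, \<theta> * w:])"
proof -
  define d where "d = size A"
  define f where "f = (\<Prod>\<theta>\<in>#A. [:\<theta>, 1:])"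
  define h where "h = (\<Prod>\<theta>\<in>#A. [:\<theta>\<^sup>2 + w\<^sup>2, \<theta> * w:])"
  \<comment> \<open>\<open>p\<close> is f(w u) as a polynomial in u. Its degree is exactly
    \<open>d\<close> since w is nonzero, so its reflection is u^d f(w/u).\<close>
  define p where "p = (\<Prod>\<theta>\<in>#A. [:\<theta>, w:])"
  have deg_f: "degree f = d"
    unfolding f_def d_def
  proof (induction A)
    case (add \<theta> A)
    have "(\<Prod>\<theta>\<in>#A. [:\<theta>, 1:]) \<noteq> 0" by (auto simp: prod_mset_zero_iff)
    with add show ?case by (simp add: degree_mult_eq del: mult_pCons_left)
  qed simp
  have p: "p = pcompose f [:0, w:]"
    unfolding p_def f_def by (induction A) (simp_all add: pcompose_mult pcompose_pCons pcompose_1 del: mult_pCons_left)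
  have coeff_p: "coeff p i = coeff f i * w ^ i" for i
    unfolding p by (simp only: coeff_pcompose_linear mult.commute)
  have deg_p: "degree p = d"
    using w by (simp add: p degree_pcompose deg_f)
  have refl: "reflect_poly p = (\<Prod>\<theta>\<in>#A. [:w, \<theta>:])"
  proof -
    have "reflect_poly [:\<theta>, w:] = [:w, \<theta>:]" for \<theta>
      using w by (simp add: reflect_poly_def cCons_def)
    then show ?thesis
      unfolding p_def by (induction A) (simp_all add: reflect_poly_mult del: mult_pCons_left)
  qed
  \<comment> \<open>Here X = u and Y = 1 + u^2, so Y/X is t = u + 1/u and the product equals u^d
    h(t).\<close>
  have "p * reflect_poly p = (\<Prod>\<theta>\<in>#A. smult (\<theta>\<^sup>2 + w\<^sup>2) [:0, 1:] + smult (\<theta> * w) [:1, 0, 1:])"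
    unfolding refl unfolding p_def prod_mset.distrib[symmetric]
    by (simp add: power2_eq_square algebra_simps)
  also have "\<dots> = (\<Sum>k\<le>d. smult (coeff h k) ([:1, 0, 1:] ^ k * [:0, 1:] ^ (d - k)))"
    unfolding h_def d_def by (rule prod_mset_homogenize)
  finally have prod: "p * reflect_poly p = (\<Sum>k\<le>d. smult (coeff h k) ([:1, 0, 1:] ^ k * [:0, 1:] ^ (d - k)))" .
  \<comment> \<open>The coefficient of u^(d+2j) in \<open>p * reflect_poly p\<close>, computed by
    convolution and from the expansion in t.\<close>
  have "(\<Sum>l\<le>d. coeff f l * coeff f (l + 2 * j) * w ^ (2 * (l + j))) =
      (\<Sum>k\<le>d. if even k then coeff h k * of_nat (k choose (k div 2 + j)) else 0)" for j
  proof -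
    have "coeff (p * reflect_poly p) (d + 2 * j) =
        (\<Sum>l\<le>d + 2 * j. coeff (reflect_poly p) l * coeff p (d + 2 * j - l))"
      by (simp add: mult.commute[of p] coeff_mult)
    also have "\<dots> = (\<Sum>l\<le>d. coeff p (d - l) * coeff p (d + 2 * j - l))"
      by (rule sum.mono_neutral_cong_right) (auto simp: coeff_reflect_poly deg_p)
    also have "\<dots> = (\<Sum>l\<le>d. coeff p l * coeff p (l + 2 * j))"
      by (rule sum.reindex_bij_witness[of _ "\<lambda>l. d - l" "\<lambda>l. d - l"]) auto
    also have "\<dots> = (\<Sum>l\<le>d. coeff f l * coeff f (l + 2 * j) * w ^ (2 * (l + j)))"
      by (intro sum.cong) (simp_all add: coeff_p power_add[symmetric] mult_ac mult_2)
    finally have 1: "coeff (p * reflect_poly p) (d + 2 * j) = \<dots>" .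
    have "coeff ([:1, 0, 1:] ^ k * [:0, 1 :: complex:] ^ (d - k)) (d + 2 * j) =
        (if even k then of_nat (k choose (k div 2 + j)) else 0)" if "k \<le> d" for k
    proof -
      have "coeff ([:1, 0, 1:] ^ k * [:0, 1 :: complex:] ^ (d - k)) (d + 2 * j) =
          coeff (monom 1 (d - k) * [:1, 0, 1:] ^ k) (d + 2 * j)"
        by (simp add: monom_altdef mult.commute)
      also have "\<dots> = coeff ([:1, 0, 1 :: complex:] ^ k) (k + 2 * j)"
        using that by (simp add: coeff_monom_mult add.commute)
      finally show ?thesis by (simp add: coeff_one_plus_square_power)
    qed
    then have "coeff (p * reflect_poly p) (d + 2 * j) =
        (\<Sum>k\<le>d. if even k then coeff h k * of_nat (k choose (k div 2 + j)) else 0)"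
      unfolding prod coeff_sum coeff_smult by (intro sum.cong) auto
    with 1 show ?thesis by simp
  qed
  then have "poly (U_op \<alpha> f) (w\<^sup>2) = (\<Sum>j\<le>d. of_real (\<alpha> j) *
      (\<Sum>k\<le>d. if even k then coeff h k * of_nat (k choose (k div 2 + j)) else 0))"
    by (subst poly_U_op_square[of f d]) (simp_all add: deg_f)
  also have "\<dots> = (\<Sum>k\<le>d. \<Sum>j\<le>d. of_real (\<alpha> j) *
      (if even k then coeff h k * of_nat (k choose (k div 2 + j)) else 0))"
    unfolding sum_distrib_left by (rule sum.swap)
  also have "\<dots> = (\<Sum>k\<le>d. U_weight \<alpha> k * coeff h k)"
  proof (rule sum.cong)
    fix k assume k: "k \<in> {..d}"
    show "(\<Sum>j\<le>d. of_real (\<alpha> j) *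
      (if even k then coeff h k * of_nat (k choose (k div 2 + j)) else 0)) = U_weight \<alpha> k * coeff h k"
    proof (cases "even k")
      case True
      have "(\<Sum>j\<le>d. of_real (\<alpha> j) * (coeff h k * of_nat (k choose (k div 2 + j)))) =
          (\<Sum>j\<le>k div 2. of_real (\<alpha> j) * (coeff h k * of_nat (k choose (k div 2 + j))))"
        using k True by (intro sum.mono_neutral_right) (auto intro!: binomial_eq_0)
      with True show ?thesis
        by (simp add: U_weight_def sum_distrib_left mult_ac)
    qed (simp add: U_weight_def)
  qed simp
  also have "\<dots> = lin_functional (U_weight \<alpha>) h"
    unfolding h_def d_def by (rule lin_functional_eq[symmetric]) (rule degree_prod_mset_linear_le)
  finally show ?thesis unfolding f_def h_def .
qed

lemma U_op_smult: "U_op \<alpha> (smult c f) = smult (c\<^sup>2) (U_op \<alpha> f)"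
proof -
  have "U_op \<alpha> (smult c f) = (\<Sum>k\<le>degree f. monom (U_coeff \<alpha> (smult c f) k) k)"
    by (rule U_op_eq) (simp add: degree_smult_le)
  moreover have "U_coeff \<alpha> (smult c f) k = c\<^sup>2 * U_coeff \<alpha> f k" for k
    by (simp add: U_coeff_eq sum_distrib_left power2_eq_square mult_ac)
  ultimately show ?thesis
    by (intro poly_eqI) (simp add: U_op_def coeff_sum sum_distrib_left)
qed

lemma degree_U_op_le: "degree (U_op \<alpha> f) \<le> degree f"
  unfolding U_op_def by (intro degree_sum_le) (auto intro: order_trans[OF degree_monom_le])

section \<open>The polynomials of (ii) and (iii) in terms of one Appell polynomial\<close>

text \<open>All \<theta> equal 1, so every factor is 1 + w^2 + w t = w (w + 1/w + t).\<close>

lemma poly_U_op_binomial: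
  assumes "w \<noteq> 0"
  shows "poly (U_op \<alpha> ([:1, 1:] ^ n)) (w\<^sup>2) = w ^ n * poly (appell (U_weight \<alpha>) n) (w + 1 / w)"
proof -
  have "[:1 + w\<^sup>2, w:] = smult w [:w + 1 / w, 1:]"
    using assms by (simp add: field_simps power2_eq_square)
  with poly_U_op_prod[OF assms, of \<alpha> "replicate_mset n 1"] show ?thesis
    by (simp only: image_replicate_mset prod_mset_replicate_mset one_power2 mult_1_left mult_1 smult_power
        lin_functional_smult lin_functional_linear_power)
qed

text \<open>Odd moments vanish, so after extracting v^n only powers of 1/v^2 remain. The factor
  (2r)! cancels between the binomials (n choose 2r) and (2r choose r+j), leaving the factorials of
  (iii).\<close>

lemma poly_appell_U_weight:
  assumes "v \<noteq> 0"
  shows "poly (appell (U_weight \<alpha>) n) v = fact n * v ^ n *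
    poly (\<Sum>k\<le>n div 2. monom (complex_of_real
      ((\<Sum>j\<le>k. \<alpha> j / (fact (k + j) * fact (k - j))) / fact (n - 2 * k))) k) ((1 / v)\<^sup>2)"
proof -
  let ?c = "U_weight \<alpha>"
  have c: "?c (2 * r) = fact (2 * r) * of_real (\<Sum>j\<le>r. \<alpha> j / (fact (r + j) * fact (r - j)))" for r
  proof -
    have "of_nat (2 * r choose (r + j)) = (fact (2 * r) / (fact (r + j) * fact (r - j)) :: complex)"
      if "j \<le> r" for j
      using that by (subst binomial_fact) (simp_all add: mult_2)
    then show ?thesis
      by (simp add: U_weight_def sum_distrib_left mult_ac)
  qed
  have "poly (appell ?c n) v = (\<Sum>k\<le>n. of_nat (n choose (n - k)) * ?c k * v ^ (n - k))"
    unfolding poly_appell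
    by (rule sum.reindex_bij_witness[of _ "\<lambda>l. n - l" "\<lambda>l. n - l"]) auto
  also have "\<dots> = (\<Sum>k\<in>(\<lambda>r. 2 * r) ` {..n div 2}. of_nat (n choose (n - k)) * ?c k * v ^ (n - k))"
  proof (rule sum.mono_neutral_right)
    show "\<forall>k\<in>{..n} - (\<lambda>r. 2 * r) ` {..n div 2}. of_nat (n choose (n - k)) * ?c k * v ^ (n - k) = 0"
    proof
      fix k assume k: "k \<in> {..n} - (\<lambda>r. 2 * r) ` {..n div 2}"
      have "odd k"
      proof
        assume "even k"
        then have "k = 2 * (k div 2)" "k div 2 \<le> n div 2" using k by auto
        with k show False by blast
      qed
      then show "of_nat (n choose (n - k)) * ?c k * v ^ (n - k) = 0"
        by (simp add: U_weight_def)
    qed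
  qed auto
  also have "\<dots> = (\<Sum>r\<le>n div 2. of_nat (n choose (n - 2 * r)) * ?c (2 * r) * v ^ (n - 2 * r))"
    by (subst sum.reindex) (auto simp: inj_on_def)
  also have "\<dots> = (\<Sum>r\<le>n div 2. fact n * v ^ n * (complex_of_real
      ((\<Sum>j\<le>r. \<alpha> j / (fact (r + j) * fact (r - j))) / fact (n - 2 * r)) * ((1 / v)\<^sup>2) ^ r))"
  proof (rule sum.cong)
    fix r assume "r \<in> {..n div 2}"
    then have r: "2 * r \<le> n" by auto
    have "of_nat (n choose (n - 2 * r)) = (fact n / (fact (n - 2 * r) * fact (2 * r)) :: complex)"
      using r by (subst binomial_fact) simp_all
    moreover have "v ^ (n - 2 * r) = v ^ n * ((1 / v)\<^sup>2) ^ r"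
      using r assms by (simp add: power_diff power_mult power_one_over)
    ultimately show "of_nat (n choose (n - 2 * r)) * ?c (2 * r) * v ^ (n - 2 * r) =
        fact n * v ^ n * (complex_of_real
      ((\<Sum>j\<le>r. \<alpha> j / (fact (r + j) * fact (r - j))) / fact (n - 2 * r)) * ((1 / v)\<^sup>2) ^ r)"
      by (simp add: c)
  qed simp
  finally show ?thesis
    by (simp add: poly_sum poly_monom sum_distrib_left)
qed

section \<open>Transfer between the slit plane and the right half-plane\<close>

lemma poly_eq_0_on_half_plane:
  fixes p :: "complex poly"
  assumes "\<And>w. Re w > 0 \<Longrightarrow> poly p w = 0"
  shows "p = 0"
proof (rule ccontr)
  assume "p \<noteq> 0"
  then have "finite {w. poly p w = 0}" by (rule poly_roots_finite)
  moreover have "(\<lambda>k. of_nat (Suc k)) ` (UNIV :: nat set) \<subseteq> {w. poly p w = 0}"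
    using assms by auto
  moreover have "infinite ((\<lambda>k. of_nat (Suc k) :: complex) ` (UNIV :: nat set))"
    by (rule range_inj_infinite) (auto simp: inj_def)
  ultimately show False using finite_subset by blast
qed

text \<open>\<open>w \<mapsto> w\<^sup>2\<close> maps the right half-plane onto the complement of \<open>(-\<infinity>, 0]\<close>.\<close>

lemma P_plus_iff:
  assumes "degree f \<le> n"
  shows "f \<in> P_plus n \<union> {0} \<longleftrightarrow>
    (\<forall>w. Re w > 0 \<longrightarrow> poly f (w\<^sup>2) \<noteq> 0) \<or> (\<forall>w. Re w > 0 \<longrightarrow> poly f (w\<^sup>2) = 0)"
    (is "_ \<longleftrightarrow> ?nz \<or> ?z")
proof -
  have slit: "\<not> (w\<^sup>2 \<in> \<real> \<and> Re (w\<^sup>2) \<le> 0)" if "Re w > 0" for w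
  proof
    assume "w\<^sup>2 \<in> \<real> \<and> Re (w\<^sup>2) \<le> 0"
    then have "Im w = 0" "(Re w)\<^sup>2 - (Im w)\<^sup>2 \<le> 0"
      using that by (auto simp: complex_is_Real_iff power2_eq_square)
    with that show False by simp
  qed
  have root: "\<exists>w. Re w > 0 \<and> w\<^sup>2 = z" if "\<not> (z \<in> \<real> \<and> Re z \<le> 0)" for z
  proof (intro exI conjI)
    \<comment> \<open>The square of Re (csqrt z) is half of this quantity, which vanishes only on
      the slit.\<close>
    have "cmod z + Re z \<noteq> 0"
    proof
      assume eq: "cmod z + Re z = 0"
      then have "(cmod z)\<^sup>2 = (Re z)\<^sup>2"
        by (simp add: eq_neg_iff_add_eq_0[symmetric])
      then have "Im z = 0" by (simp add: cmod_power2)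
      moreover have "Re z \<le> 0" using eq norm_ge_zero[of z] by linarith
      ultimately show False using that by (simp add: complex_is_Real_iff)
    qed
    moreover have "cmod z + Re z \<ge> 0" using abs_Re_le_cmod[of z] by linarith
    ultimately show "Re (csqrt z) > 0" by simp
  qed simp
  have nz: "?nz \<longleftrightarrow> (\<forall>z. poly f z = 0 \<longrightarrow> z \<in> \<real> \<and> Re z \<le> 0)"
    using slit root by metis
  have "?z \<longleftrightarrow> f = 0"
  proof
    assume z: ?z
    have "pcompose f (monom 1 2) = 0"
      by (rule poly_eq_0_on_half_plane) (use z in \<open>simp add: poly_pcompose poly_monom\<close>)
    then show "f = 0"
      by (rule pcompose_eq_0) (simp add: degree_monom_eq)
  qed simp
  moreover have "f \<noteq> 0" if ?nz
    using that[rule_format, of 1] by auto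
  ultimately show ?thesis
    using assms nz by (auto simp: P_plus_def)
qed

text \<open>Solve w^2 - v w + 1 = 0. Any root works: Re w \<le> 0 would give Re (1/w) \<le> 0 and
  hence Re v \<le> 0.\<close>

lemma half_plane_joukowski_surj:
  assumes "Re v > 0"
  obtains w where "Re w > 0" "w + 1 / w = v"
proof -
  define w where "w = (v + csqrt (v\<^sup>2 - 4)) / 2"
  have "(2 * w - v)\<^sup>2 = v\<^sup>2 - 4"
    by (simp add: w_def del: distrib_left_numeral)
  then have "4 * (w * w + 1 - v * w) = 0"
    by (simp add: power2_eq_square algebra_simps)
  then have eq: "w * w + 1 = v * w" by (simp only: mult_eq_0_iff) simp
  then have "w \<noteq> 0" by auto
  with eq have w: "w + 1 / w = v" by (simp add: field_simps)
  have "Re w > 0"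
  proof (rule ccontr)
    assume "\<not> Re w > 0"
    then have "Re (1 / w) \<le> 0"
      by (simp add: Re_complex_div_le_0)
    with \<open>\<not> Re w > 0\<close> assms show False
      unfolding w[symmetric] by simp
  qed
  with w show thesis using that by blast
qed

lemma Re_inverse_pos: "Re w > 0 \<Longrightarrow> Re (1 / w) > 0"
  by (simp add: Re_complex_div_gt_0)

section \<open>Preservation of \<open>P_plus n\<close> and the equivalences\<close>

lemma U_op_in_P_plus:
  assumes stable: "(\<forall>v. Re v > 0 \<longrightarrow> poly (appell (U_weight \<alpha>) n) v \<noteq> 0) \<or> appell (U_weight \<alpha>) n = 0"
    and f: "f \<in> P_plus n"
  shows "U_op \<alpha> f \<in> P_plus n \<union> {0}"
proof -
  let ?c = "U_weight \<alpha>"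
  have f0: "f \<noteq> 0" and deg: "degree f \<le> n" and roots: "\<And>z. poly f z = 0 \<Longrightarrow> z \<in> \<real> \<and> Re z \<le> 0"
    using f by (auto simp: P_plus_def)
  obtain A where A: "size A = degree f" "f = smult (lead_coeff f) (\<Prod>x\<in>#A. [:-x, 1:])"
    "\<And>x. x \<in># A \<Longrightarrow> poly f x = 0"
    using poly_roots_exist[OF f0] by blast
  define T where "T = image_mset uminus A"
  \<comment> \<open>A factor with \<theta> = 0 becomes the constant w^2 and yields no factor v + t.
    Together with deg f < n this is why Appell polynomials of orders below \<open>n\<close>
    occur.\<close>
  define B where "B = filter_mset (\<lambda>\<theta>. \<theta> \<noteq> 0) T"
  have T: "f = smult (lead_coeff f) (\<Prod>\<theta>\<in>#T. [:\<theta>, 1:])"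
    using A(2) by (simp add: T_def image_mset.compositionality comp_def)
  have T_pos: "\<theta> \<in> \<real>" "Re \<theta> \<ge> 0" if "\<theta> \<in># T" for \<theta>
    using that A(3) roots by (auto simp: T_def)
  have "size B \<le> size T"
    unfolding B_def by (rule size_filter_mset_lesseq)
  then have B_le: "size B \<le> n"
    using deg A(1) by (simp add: T_def)
  have B: "\<exists>t > 0. \<theta> = of_real t" if "\<theta> \<in># B" for \<theta>
  proof -
    from that have "\<theta> \<in># T" "\<theta> \<noteq> 0" by (auto simp: B_def)
    with T_pos[of \<theta>] show ?thesis
      by (auto elim!: Reals_cases)
  qed
  have key: "\<exists>k. k \<noteq> 0 \<and> poly (U_op \<alpha> f) (w\<^sup>2) =
      k * lin_functional ?c (\<Prod>v\<in>#image_mset (\<lambda>\<theta>. \<theta> / w + w / \<theta>) B. [:v, 1:])"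
    if w: "w \<noteq> 0" for w
  proof -
    have "\<exists>k. k \<noteq> 0 \<and> (\<Prod>\<theta>\<in>#T. [:\<theta>\<^sup>2 + w\<^sup>2, \<theta> * w:]) =
        smult k (\<Prod>\<theta>\<in>#filter_mset (\<lambda>\<theta>. \<theta> \<noteq> 0) T. [:\<theta> / w + w / \<theta>, 1:])"
    proof (induction T)
      case empty
      show ?case by (intro exI[of _ 1]) simp
    next
      case (add \<theta> T)
      then obtain k where k: "k \<noteq> 0" "(\<Prod>\<theta>\<in>#T. [:\<theta>\<^sup>2 + w\<^sup>2, \<theta> * w:]) =
        smult k (\<Prod>\<theta>\<in>#filter_mset (\<lambda>\<theta>. \<theta> \<noteq> 0) T. [:\<theta> / w + w / \<theta>, 1:])" by blast
      show ?case
      proof (cases "\<theta> = 0")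
        case True
        with k w show ?thesis by (intro exI[of _ "w\<^sup>2 * k"]) (simp add: mult.commute)
      next
        case False
        then have "[:\<theta>\<^sup>2 + w\<^sup>2, \<theta> * w:] = smult (\<theta> * w) [:\<theta> / w + w / \<theta>, 1:]"
          using w by (simp add: field_simps power2_eq_square)
        with k w False show ?thesis
          by (intro exI[of _ "\<theta> * w * k"]) (simp add: mult_ac del: mult_pCons_left smult_pCons)
      qed
    qed
    then obtain k where k: "k \<noteq> 0" "(\<Prod>\<theta>\<in>#T. [:\<theta>\<^sup>2 + w\<^sup>2, \<theta> * w:]) =
        smult k (\<Prod>v\<in>#image_mset (\<lambda>\<theta>. \<theta> / w + w / \<theta>) B. [:v, 1:])"
      unfolding B_def by (auto simp: image_mset.compositionality comp_def)
    have "poly (U_op \<alpha> f) (w\<^sup>2) =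
        (lead_coeff f)\<^sup>2 * lin_functional ?c (\<Prod>\<theta>\<in>#T. [:\<theta>\<^sup>2 + w\<^sup>2, \<theta> * w:])"
      by (subst T) (simp only: U_op_smult poly_smult poly_U_op_prod[OF w])
    also have "\<dots> = ((lead_coeff f)\<^sup>2 * k) *
        lin_functional ?c (\<Prod>v\<in>#image_mset (\<lambda>\<theta>. \<theta> / w + w / \<theta>) B. [:v, 1:])"
      by (simp only: k(2) lin_functional_smult mult.assoc)
    finally show ?thesis
      using k(1) f0 by (intro exI[of _ "(lead_coeff f)\<^sup>2 * k"]) simp
  qed
  \<comment> \<open>The alternative depends on \<open>size B\<close> but not on w, so it holds
    uniformly over the half-plane.\<close>
  from appell_stable_or_zero[OF stable B_le]
  have "(\<forall>w. Re w > 0 \<longrightarrow> poly (U_op \<alpha> f) (w\<^sup>2) \<noteq> 0) \<or> (\<forall>w. Re w > 0 \<longrightarrow> poly (U_op \<alpha> f) (w\<^sup>2) = 0)"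
  proof (rule disj_forward; intro allI impI)
    fix w :: complex
    assume stable: "\<forall>v. Re v > 0 \<longrightarrow> poly (appell ?c (size B)) v \<noteq> 0" and w: "Re w > 0"
    have "Re (\<theta> / w + w / \<theta>) > 0" if "\<theta> \<in># B" for \<theta>
      using B[OF that] w Re_inverse_pos[OF w] by (auto simp: Re_divide_of_real complex_eq_iff divide_inverse intro!: add_pos_pos)
    then have "lin_functional ?c (\<Prod>v\<in>#image_mset (\<lambda>\<theta>. \<theta> / w + w / \<theta>) B. [:v, 1:]) \<noteq> 0"
      using stable by (intro grace_walsh_szego) auto
    moreover have "w \<noteq> 0" using w by auto
    ultimately show "poly (U_op \<alpha> f) (w\<^sup>2) \<noteq> 0"
      using key[of w] by auto
  next
    fix w :: complex
    assume zero: "appell ?c (size B) = 0" and w: "Re w > 0"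
    have "degree (\<Prod>v\<in>#image_mset (\<lambda>\<theta>. \<theta> / w + w / \<theta>) B. [:v, 1:]) \<le> size B"
      using degree_prod_mset_linear_le[where A = B and b = "\<lambda>\<theta>. \<theta> / w + w / \<theta>" and a = "\<lambda>_. 1"]
      by (simp add: image_mset.compositionality comp_def)
    then have "lin_functional ?c (\<Prod>v\<in>#image_mset (\<lambda>\<theta>. \<theta> / w + w / \<theta>) B. [:v, 1:]) = 0"
      by (rule lin_functional_eq_0_if_appell_eq_0[OF zero])
    moreover have "w \<noteq> 0" using w by auto
    ultimately show "poly (U_op \<alpha> f) (w\<^sup>2) = 0"
      using key[of w] by auto
  qed
  with deg show ?thesis
    by (subst P_plus_iff) (auto intro: order_trans[OF degree_U_op_le])
qed

theorem theorem4p2: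
  fixes \<alpha> :: "nat \<Rightarrow> real" and n :: nat
  shows
    "(U_op \<alpha> ` P_plus n \<subseteq> P_plus n \<union> {0} \<longleftrightarrow>
        U_op \<alpha> ([:1, 1:] ^ n) \<in> P_plus n \<union> {0})
     \<and>
     (U_op \<alpha> ([:1, 1:] ^ n) \<in> P_plus n \<union> {0} \<longleftrightarrow>
        (\<Sum>k\<le>n div 2. monom (complex_of_real
            ((\<Sum>j\<le>k. \<alpha> j / (fact (k + j) * fact (k - j))) / fact (n - 2 * k))) k)
          \<in> P_plus n \<union> {0})"
proof -
  let ?G = "appell (U_weight \<alpha>) n"
  let ?P = "\<Sum>k\<le>n div 2. monom (complex_of_real
            ((\<Sum>j\<le>k. \<alpha> j / (fact (k + j) * fact (k - j))) / fact (n - 2 * k))) k"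
  let ?U = "U_op \<alpha> ([:1, 1:] ^ n)"
  have U: "poly ?U (w\<^sup>2) = 0 \<longleftrightarrow> poly ?G (w + 1 / w) = 0" if "Re w > 0" for w
  proof -
    have "w \<noteq> 0" using that by auto
    then show ?thesis by (simp add: poly_U_op_binomial)
  qed
  have P: "poly ?P ((1 / v)\<^sup>2) = 0 \<longleftrightarrow> poly ?G v = 0" if "Re v > 0" for v
  proof -
    have "v \<noteq> 0" using that by auto
    then show ?thesis by (subst poly_appell_U_weight) simp_all
  qed
  \<comment> \<open>Inversion is a bijection of the right half-plane. Taking \<open>Q\<close> as
    negation or identity transfers both absence of zeros and identical vanishing.\<close>
  have P_all: "(\<forall>w. Re w > 0 \<longrightarrow> Q (poly ?P (w\<^sup>2) = 0)) \<longleftrightarrow> (\<forall>v. Re v > 0 \<longrightarrow> Q (poly ?G v = 0))" for Q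
  proof (intro iffI allI impI)
    fix v :: complex
    assume "\<forall>w. Re w > 0 \<longrightarrow> Q (poly ?P (w\<^sup>2) = 0)" and v: "Re v > 0"
    with Re_inverse_pos[OF v] have "Q (poly ?P ((1 / v)\<^sup>2) = 0)" by blast
    then show "Q (poly ?G v = 0)" unfolding P[OF v] .
  next
    fix w :: complex
    assume "\<forall>v. Re v > 0 \<longrightarrow> Q (poly ?G v = 0)" and w: "Re w > 0"
    with Re_inverse_pos[OF w] have "Q (poly ?G (1 / w) = 0)" by blast
    then show "Q (poly ?P (w\<^sup>2) = 0)"
      unfolding P[OF Re_inverse_pos[OF w], symmetric] by simp
  qed
  have U_all: "(\<forall>w. Re w > 0 \<longrightarrow> Q (poly ?U (w\<^sup>2) = 0)) \<longleftrightarrow> (\<forall>v. Re v > 0 \<longrightarrow> Q (poly ?G v = 0))" for Q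
  proof (intro iffI allI impI)
    fix v :: complex
    assume all: "\<forall>w. Re w > 0 \<longrightarrow> Q (poly ?U (w\<^sup>2) = 0)" and "Re v > 0"
    then obtain w where w: "Re w > 0" "w + 1 / w = v"
      using half_plane_joukowski_surj by blast
    from all w(1) have "Q (poly ?U (w\<^sup>2) = 0)" by blast
    then show "Q (poly ?G v = 0)" unfolding U[OF w(1)] w(2) .
  next
    fix w :: complex
    assume "\<forall>v. Re v > 0 \<longrightarrow> Q (poly ?G v = 0)" and w: "Re w > 0"
    moreover have "Re (w + 1 / w) > 0"
      using w Re_inverse_pos[OF w] by simp
    ultimately show "Q (poly ?U (w\<^sup>2) = 0)"
      unfolding U[OF w] by blast
  qed
  have deg_1: "degree ([:1, 1 :: complex:] ^ n) \<le> n"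
    using degree_power_le[of "[:1, 1 :: complex:]" n] by simp
  have deg_U: "degree ?U \<le> n"
    using degree_U_op_le deg_1 by (rule order_trans)
  have deg_P: "degree ?P \<le> n"
    by (intro degree_sum_le) (auto intro: order_trans[OF degree_monom_le])
  have U_iff: "?U \<in> P_plus n \<union> {0} \<longleftrightarrow>
      (\<forall>v. Re v > 0 \<longrightarrow> poly ?G v \<noteq> 0) \<or> (\<forall>v. Re v > 0 \<longrightarrow> poly ?G v = 0)"
    unfolding P_plus_iff[OF deg_U] using U_all[of Not] U_all[of "\<lambda>b. b"] by simp
  have P_iff: "?P \<in> P_plus n \<union> {0} \<longleftrightarrow>
      (\<forall>v. Re v > 0 \<longrightarrow> poly ?G v \<noteq> 0) \<or> (\<forall>v. Re v > 0 \<longrightarrow> poly ?G v = 0)"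
    unfolding P_plus_iff[OF deg_P] using P_all[of Not] P_all[of "\<lambda>b. b"] by simp
  have "[:1, 1:] ^ n \<in> P_plus n"
    using deg_1 by (auto simp: P_plus_def add_eq_0_iff)
  moreover have "U_op \<alpha> ` P_plus n \<subseteq> P_plus n \<union> {0}" if "?U \<in> P_plus n \<union> {0}"
  proof -
    \<comment> \<open>Vanishing on the whole half-plane is upgraded to \<open>?G = 0\<close>, which
      makes the moments available.\<close>
    have "(\<forall>v. Re v > 0 \<longrightarrow> poly ?G v \<noteq> 0) \<or> ?G = 0"
      using that poly_eq_0_on_half_plane unfolding U_iff by blast
    then show ?thesis using U_op_in_P_plus by blast
  qed
  ultimately show ?thesis
    unfolding P_iff U_iff[symmetric] by blast
qed

end
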